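(* Let $X\subset\mathbb{R}^n$ be a Delone set. If there is a single value of $T>0$ such that $$M_X(T) < \frac{1}{3}\,T,$$ then $X$ is an ideal crystal.
   Context: A Delone set in $\mathbb{R}^n$ is a discrete set $X \subset \mathbb{R}^n$ that is uniformly discrete (its packing radius by equal balls, i.e. half the infimum of the distances between distinct points of $X$, is positive) and relatively dense (its covering radius, i.e. the smallest radius such that the closed balls of that radius centered at points of $X$ cover $\mathbb{R}^n$, is finite). For $\mathbf{x}\in X$ and $T>0$, the $T$-patch of $X$ centered at $\mathbf{x}$ is $\mathcal{P}_X(\mathbf{x};T) = X\cap B(\mathbf{x};T)$, where $B(\mathbf{x};T)$ is the open ball with center $\mathbf{x}$ and radius $T$. Two patches are translation-equivalent, $\mathcal{P}_X(\mathbf{x};T)\sim\mathcal{P}_X(\mathbf{y};T)$, if $\mathcal{P}_X(\mathbf{y};T)=\mathcal{P}_X(\mathbf{x};T)+\mathbf{y}-\mathbf{x}$. The repetitivity function $M_X(T)$ is the least $M$ (possibly infinite) such that every closed ball of radius $M$ contains the center of a $T$-patch of every kind that occurs in $X$; that is, for every $\mathbf{x}\in X$, every closed ball of radius $M$ in $\mathbb{R}^n$ contains a point $\mathbf{y}\in X$ with $\mathcal{P}_X(\mathbf{y};T)\sim\mathcal{P}_X(\mathbf{x};T)$ (the patch itself may extend outside the ball). A Delone set $X$ in $\mathbb{R}^n$ is an ideal crystal if it has a full rank lattice of translation symmetries, i.e. $X=\Lambda+F$ where $\Lambda$ is a full rank lattice in $\mathbb{R}^n$ and $F$ is a finite set.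 *)

theory Defs
  imports "HOL-Analysis.Analysis"
begin

text \<open>
  Both radii are extended reals; the packing radius of a set with at most one point
  is \<open>\<infinity>\<close>, and the covering radius is \<open>\<infinity>\<close> when no radius works.
\<close>

definition packing_radius :: "'a::metric_space set \<Rightarrow> ereal" where
  "packing_radius X = (INF (x, y) \<in> {(x, y). x \<in> X \<and> y \<in> X \<and> x \<noteq> y}. ereal (dist x y)) / 2"

definition covering_radius :: "'a::metric_space set \<Rightarrow> ereal" where
  "covering_radius X = Inf {ereal R | R. (\<Union>x\<in>X. cball x R) = UNIV}"

definition uniformly_discrete :: "'a::metric_space set \<Rightarrow> bool" where
  "uniformly_discrete X \<longleftrightarrow> packing_radius X > 0"

lemma uniformly_discrete_iff_uniform_discrete: "uniformly_discrete X \<longleftrightarrow> uniform_discrete X"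
proof
  assume "uniformly_discrete X"
  then have "0 < (INF (x, y) \<in> {(x, y). x \<in> X \<and> y \<in> X \<and> x \<noteq> y}. ereal (dist x y))"
    unfolding uniformly_discrete_def packing_radius_def
    by (cases "INF (x, y) \<in> {(x, y). x \<in> X \<and> y \<in> X \<and> x \<noteq> y}. ereal (dist x y)") auto
  then obtain e where e: "0 < ereal e"
    "ereal e < (INF (x, y) \<in> {(x, y). x \<in> X \<and> y \<in> X \<and> x \<noteq> y}. ereal (dist x y))"
    using ereal_dense2 by blast
  have "e < dist x y" if "x \<in> X" "y \<in> X" "x \<noteq> y" for x y
    using less_INF_D[OF e(2), of "(x, y)"] that by simp
  then show "uniform_discrete X"
    unfolding uniform_discrete_def using e(1) by (metis ereal_less(2) order.asym)
next
  assume "uniform_discrete X"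
  then obtain e where e: "e > 0" "\<And>x y. x \<in> X \<Longrightarrow> y \<in> X \<Longrightarrow> dist x y < e \<Longrightarrow> x = y"
    unfolding uniform_discrete_def by blast
  have "ereal e \<le> (INF (x, y) \<in> {(x, y). x \<in> X \<and> y \<in> X \<and> x \<noteq> y}. ereal (dist x y))"
    using e(2) by (intro INF_greatest) (force simp: not_less[symmetric])
  then have "ereal e / 2 \<le> packing_radius X"
    unfolding packing_radius_def by (intro ereal_divide_right_mono) auto
  moreover have "0 < ereal e / 2" using e(1) by simp
  ultimately show "uniformly_discrete X"
    unfolding uniformly_discrete_def by (rule less_le_trans[rotated])
qed

definition relatively_dense :: "'a::metric_space set \<Rightarrow> bool" where
  "relatively_dense X \<longleftrightarrow> covering_radius X < \<infinity>"

definition Delone :: "'a::metric_space set \<Rightarrow> bool" where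
  "Delone X \<longleftrightarrow> discrete X \<and> uniformly_discrete X \<and> relatively_dense X"

definition patch :: "'a::metric_space set \<Rightarrow> 'a \<Rightarrow> real \<Rightarrow> 'a set" where
  "patch X x T = X \<inter> ball x T"

definition patch_equiv :: "'a::real_normed_vector set \<Rightarrow> real \<Rightarrow> 'a \<Rightarrow> 'a \<Rightarrow> bool" where
  "patch_equiv X T x y \<longleftrightarrow> patch X y T = (\<lambda>p. p + y - x) ` patch X x T"

text \<open>
  The least admissible \<open>M\<close> is rendered as an infimum in the extended reals, with value \<open>\<infinity>\<close>
  when no real \<open>M\<close> is admissible. If \<open>X\<close> is nonempty, admissible \<open>M\<close> are nonnegative,
  since \<open>cball c M\<close> is empty for \<open>M < 0\<close>.
\<close>

definition repetitivity :: "'a::real_normed_vector set \<Rightarrow> real \<Rightarrow> ereal" where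
  "repetitivity X T =
     Inf {ereal M | M. \<forall>x\<in>X. \<forall>c. \<exists>y\<in>X. y \<in> cball c M \<and> patch_equiv X T x y}"

text \<open>A full rank lattice is the set of integer combinations of a vector space basis.\<close>

definition full_rank_lattice :: "'a::euclidean_space set \<Rightarrow> bool" where
  "full_rank_lattice L \<longleftrightarrow>
     (\<exists>B. independent B \<and> span B = UNIV \<and>
          L = range (\<lambda>k :: 'a \<Rightarrow> int. \<Sum>b\<in>B. of_int (k b) *\<^sub>R b))"

definition ideal_crystal :: "'a::euclidean_space set \<Rightarrow> bool" where
  "ideal_crystal X \<longleftrightarrow> Delone X \<and>
     (\<exists>L F. full_rank_lattice L \<and> finite F \<and> X = {l + f | l f. l \<in> L \<and> f \<in> F})"

end

theory Submission
  imports Defs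
begin

text \<open>
  Let \<open>M\<close> be an admissible radius for \<open>T\<close>-patches. Two occurrences \<open>x\<close> and \<open>x + v\<close> of the same
  patch show that \<open>X\<close> agrees with its translate by \<open>v\<close> near \<open>x\<close>, namely for all pairs \<open>p\<close>,
  \<open>p + v\<close> inside \<open>ball x T\<close>. This is a property of the patch at \<open>x\<close> alone, so it holds around
  every other occurrence of that patch, and some occurrence lies within \<open>M\<close> of any given point.
  Placing it within \<open>M\<close> of the midpoint of an arbitrary pair \<open>p\<close>, \<open>p + v\<close> puts both points into
  the copy of the patch as soon as \<open>M + norm v / 2 < T\<close>. Hence such a \<open>v\<close> is a global period
  of \<open>X\<close> (\<open>short_return_vector_is_period\<close>).

  A ball of radius \<open>M\<close> centred at distance \<open>r > M\<close> from \<open>x\<close> contains a further occurrence of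
  the patch at \<open>x\<close>. Varying the direction of the centre gives return vectors \<open>v\<close> of length at
  most \<open>M + r\<close> in every open half space. When \<open>M < T / 2\<close>, in particular when \<open>M < T / 3\<close>,
  some \<open>r > M\<close> keeps these vectors short enough to be periods, and so the periods span the
  space (\<open>periods_span\<close>). Any basis consisting of periods generates a lattice of periods, and a
  representative of each orbit lies in a bounded parallelepiped, which contains only finitely
  many points of the uniformly discrete set \<open>X\<close>.
\<close>

definition periods :: "'a::real_vector set \<Rightarrow> 'a set" where
  "periods X = {v. \<forall>p. p + v \<in> X \<longleftrightarrow> p \<in> X}"

lemma period_iff: "v \<in> periods X \<Longrightarrow> p + v \<in> X \<longleftrightarrow> p \<in> X"
  by (simp add: periods_def)

lemma zero_in_periods: "0 \<in> periods X"
  by (simp add: periods_def)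

lemma periods_add:
  assumes "v \<in> periods X" "w \<in> periods X"
  shows "v + w \<in> periods X"
  using assms unfolding periods_def by (simp flip: add.assoc)

lemma periods_uminus:
  assumes "v \<in> periods X"
  shows "- v \<in> periods X"
  unfolding periods_def
proof (intro CollectI allI)
  fix p
  show "p + - v \<in> X \<longleftrightarrow> p \<in> X"
    using period_iff[OF assms, of "p - v"] by simp
qed

lemma periods_scale_nat:
  assumes "v \<in> periods X"
  shows "of_nat n *\<^sub>R v \<in> periods X"
  by (induction n) (auto simp: zero_in_periods scaleR_left_distrib intro: periods_add assms)

lemma periods_scale_int:
  assumes "v \<in> periods X"
  shows "of_int k *\<^sub>R v \<in> periods X"
proof (cases k)
  case (nonneg n)
  then show ?thesis using periods_scale_nat[OF assms] by simp
next
  case (neg n)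
  then show ?thesis
    using periods_uminus[OF periods_scale_nat[OF assms, of "Suc n"]]
    by (simp flip: scaleR_minus_left)
qed

lemma periods_sum:
  assumes "\<And>i. i \<in> I \<Longrightarrow> f i \<in> periods X"
  shows "sum f I \<in> periods X"
  using assms
  by (induction I rule: infinite_finite_induct) (auto simp: zero_in_periods periods_add)

lemma patch_equiv_mem_iff:
  fixes X :: "'a::real_normed_vector set"
  assumes "patch_equiv X T x y" "q \<in> ball x T"
  shows "q + (y - x) \<in> X \<longleftrightarrow> q \<in> X"
proof -
  have "q + (y - x) \<in> ball y T"
    using assms(2) by (simp add: dist_norm algebra_simps)
  then have "q + (y - x) \<in> X \<longleftrightarrow> q + (y - x) \<in> patch X y T"
    by (simp add: patch_def)
  also have "\<dots> \<longleftrightarrow> q + (y - x) \<in> (\<lambda>p. p + y - x) ` patch X x T"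
    using assms(1) by (simp add: patch_equiv_def)
  also have "\<dots> \<longleftrightarrow> q \<in> patch X x T"
    by (auto simp: algebra_simps image_iff)
  also have "\<dots> \<longleftrightarrow> q \<in> X"
    using assms(2) by (simp add: patch_def)
  finally show ?thesis .
qed

text \<open>
  The vector \<open>y - x\<close> is a period of \<open>X\<close> within \<open>ball x T\<close>, hence within every equivalent
  patch. The length bound is what makes a patch centred within \<open>M\<close> of the midpoint of \<open>p\<close> and
  \<open>p + (y - x)\<close> contain both of these points.
\<close>

lemma short_return_vector_is_period:
  fixes X :: "'a::real_normed_vector set"
  assumes rep: "\<And>c. \<exists>z\<in>X. z \<in> cball c M \<and> patch_equiv X T x z"
    and equiv: "patch_equiv X T x y"
    and short: "norm (y - x) < 2 * (T - M)"
  shows "y - x \<in> periods X"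
  unfolding periods_def
proof (intro CollectI allI)
  fix p
  define v where "v = y - x"
  obtain z where z: "z \<in> cball (p + v /\<^sub>R 2) M" "patch_equiv X T x z"
    using rep by blast
  define q where "q = p - (z - x)"
  have half: "norm (v /\<^sub>R 2) < T - M"
    using short by (simp add: v_def)
  have mid: "norm (z - (p + v /\<^sub>R 2)) \<le> M"
    using z(1) by (simp add: dist_norm norm_minus_commute)
  have "x - q = (z - (p + v /\<^sub>R 2)) + v /\<^sub>R 2"
    by (simp add: q_def algebra_simps)
  then have q: "q \<in> ball x T"
    using norm_triangle_ineq[of "z - (p + v /\<^sub>R 2)" "v /\<^sub>R 2"] half mid
    by (simp add: dist_norm)
  have "v = v /\<^sub>R 2 + v /\<^sub>R 2"
    by (simp flip: scaleR_left_distrib)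
  then have "x - (q + v) = (z - (p + v /\<^sub>R 2)) - v /\<^sub>R 2"
    by (simp add: q_def algebra_simps)
  then have qv: "q + v \<in> ball x T"
    using norm_triangle_ineq4[of "z - (p + v /\<^sub>R 2)" "v /\<^sub>R 2"] half mid
    by (simp add: dist_norm)
  have "p + v \<in> X \<longleftrightarrow> q + v \<in> X"
    using patch_equiv_mem_iff[OF z(2) qv] by (simp add: q_def algebra_simps)
  also have "\<dots> \<longleftrightarrow> q \<in> X"
    using patch_equiv_mem_iff[OF equiv q] by (simp add: v_def)
  also have "\<dots> \<longleftrightarrow> p \<in> X"
    using patch_equiv_mem_iff[OF z(2) q] by (simp add: q_def)
  finally show "p + (y - x) \<in> X \<longleftrightarrow> p \<in> X"
    by (simp add: v_def)
qed

text \<open>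
  If the periods lay in a proper subspace, they would be orthogonal to some unit vector \<open>u\<close>. A
  ball of radius \<open>M\<close> centred at distance more than \<open>M\<close> from \<open>x\<close> in direction \<open>u\<close> contains an
  occurrence of the patch at \<open>x\<close>, and the return vector to it has a positive component along \<open>u\<close>.
\<close>

lemma periods_span:
  fixes X :: "'a::euclidean_space set"
  assumes "x \<in> X"
    and rep: "\<And>c. \<exists>z\<in>X. z \<in> cball c M \<and> patch_equiv X T x z"
    and "M < T / 2"
  shows "span (periods X) = UNIV"
proof (rule ccontr)
  assume "span (periods X) \<noteq> UNIV"
  then obtain a where "a \<noteq> 0" and a: "\<And>v. v \<in> span (periods X) \<Longrightarrow> orthogonal a v"
    using orthogonal_to_subspace_exists_gen[of "periods X" UNIV] by auto
  define u where "u = sgn a"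
  have u: "norm u = 1" "\<And>v. v \<in> periods X \<Longrightarrow> u \<bullet> v = 0"
    using \<open>a \<noteq> 0\<close> a[OF span_base]
    by (auto simp: u_def norm_sgn sgn_div_norm orthogonal_def)
  \<comment> \<open>the midpoint of the possible offsets, which range from \<open>M\<close> to \<open>2 * (T - M) - M\<close>\<close>
  define r where "r = T - M"
  have r: "M < r" "M + r < 2 * (T - M)"
    using \<open>M < T / 2\<close> by (auto simp: r_def)
  obtain y where y: "y \<in> cball (x + r *\<^sub>R u) M" "patch_equiv X T x y"
    using rep by blast
  define e where "e = (y - x) - r *\<^sub>R u"
  have e: "norm e \<le> M"
    using y(1) by (simp add: e_def dist_norm norm_minus_commute algebra_simps)
  have "0 \<le> r"
    using e r(1) norm_ge_zero[of e] by linarith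
  have "norm (y - x) \<le> norm e + norm (r *\<^sub>R u)"
    using norm_triangle_ineq[of e "r *\<^sub>R u"] by (simp add: e_def)
  then have "norm (y - x) < 2 * (T - M)"
    using e r(2) u(1) \<open>0 \<le> r\<close> by simp
  then have "u \<bullet> (y - x) = 0"
    using u(2) short_return_vector_is_period[OF rep y(2)] by blast
  moreover have "u \<bullet> (y - x) = u \<bullet> e + r"
    using u(1) by (simp add: e_def inner_diff_right dot_square_norm)
  moreover have "\<bar>u \<bullet> e\<bar> \<le> M"
    using Cauchy_Schwarz_ineq2[of u e] e u(1) by simp
  ultimately show False
    using r(1) by linarith
qed

text \<open>
  Rounding down the coordinates of a point of \<open>X\<close> with respect to a basis of periods translates
  it, within \<open>X\<close>, into the fundamental parallelepiped of that basis.
\<close>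

lemma periods_span_imp_ideal_crystal:
  fixes X :: "'a::euclidean_space set"
  assumes "Delone X" and "span (periods X) = UNIV"
  shows "ideal_crystal X"
proof -
  obtain B where B: "B \<subseteq> periods X" "independent B" "periods X \<subseteq> span B"
    using maximal_independent_subset by blast
  have span_B: "span B = UNIV"
    using assms(2) span_mono[OF B(3)] by (simp add: span_span top.extremum_unique)
  have fin_B: "finite B"
    using B(2) by (rule independent_imp_finite)
  define L where "L = range (\<lambda>k :: 'a \<Rightarrow> int. \<Sum>b\<in>B. of_int (k b) *\<^sub>R b)"
  \<comment> \<open>this ball contains the parallelepiped of the combinations of \<open>B\<close> with coefficients in \<open>[0, 1)\<close>\<close>
  define F where "F = X \<inter> cball 0 (\<Sum>b\<in>B. norm b)"
  have L_periods: "L \<subseteq> periods X"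
    using B(1) by (auto simp: L_def intro!: periods_sum periods_scale_int)
  have "uniform_discrete F"
    using assms(1) uniform_discrete_subset[of X F]
    by (auto simp: Delone_def uniformly_discrete_iff_uniform_discrete F_def uniform_discrete_def)
  moreover have "bounded F"
    unfolding F_def by (rule bounded_subset[OF bounded_cball]) auto
  ultimately have "finite F"
    using uniform_discrete_finite_iff by blast
  have "\<exists>l\<in>L. \<exists>f\<in>F. x = l + f" if "x \<in> X" for x
  proof -
    have "x \<in> span B"
      using span_B by simp
    then obtain r where r: "x = (\<Sum>b\<in>B. r b *\<^sub>R b)"
      using span_finite[OF fin_B] by auto
    define l where "l = (\<Sum>b\<in>B. of_int \<lfloor>r b\<rfloor> *\<^sub>R b)"
    have "l \<in> L"
      by (auto simp: L_def l_def)
    have "x - l = (\<Sum>b\<in>B. frac (r b) *\<^sub>R b)"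
      by (simp add: r l_def frac_def scaleR_left_diff_distrib sum_subtractf)
    moreover have "norm (\<Sum>b\<in>B. frac (r b) *\<^sub>R b) \<le> (\<Sum>b\<in>B. norm b)"
    proof (rule sum_norm_le)
      fix b
      show "norm (frac (r b) *\<^sub>R b) \<le> norm b"
        using frac_lt_1[of "r b"] by (simp add: mult_left_le_one_le)
    qed
    ultimately have "norm (x - l) \<le> (\<Sum>b\<in>B. norm b)"
      by simp
    moreover have "x - l \<in> X"
      using period_iff[of l X "x - l"] L_periods \<open>l \<in> L\<close> that by auto
    ultimately have "x - l \<in> F"
      by (simp add: F_def)
    then show ?thesis
      using \<open>l \<in> L\<close> by (intro bexI[of _ l] bexI[of _ "x - l"]) auto
  qed
  moreover have "l + f \<in> X" if "l \<in> L" "f \<in> F" for l f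
    using period_iff[of l X f] L_periods that by (auto simp: F_def add.commute)
  ultimately have "X = {l + f | l f. l \<in> L \<and> f \<in> F}"
    by blast
  moreover have "full_rank_lattice L"
    unfolding full_rank_lattice_def using B(2) span_B L_def by blast
  ultimately show ?thesis
    unfolding ideal_crystal_def using assms(1) \<open>finite F\<close> by blast
qed

lemma Delone_nonempty:
  assumes "Delone X"
  shows "X \<noteq> {}"
  using assms by (auto simp: Delone_def relatively_dense_def covering_radius_def top_ereal_def)

theorem theorem2p2:
  fixes X :: "(real ^ 'n) set"
  assumes "Delone X"
    and "\<exists>T>0. repetitivity X T < ereal (1 / 3 * T)"
  shows "ideal_crystal X"
proof -
  obtain T where T: "T > 0" "repetitivity X T < ereal (1 / 3 * T)"
    using assms(2) by blast
  obtain M where M: "M < 1 / 3 * T"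
    and rep: "\<And>x c. x \<in> X \<Longrightarrow> \<exists>y\<in>X. y \<in> cball c M \<and> patch_equiv X T x y"
    using T(2) unfolding repetitivity_def Inf_less_iff by auto
  obtain x where "x \<in> X"
    using Delone_nonempty[OF assms(1)] by blast
  have "M < T / 2"
    using M T(1) by simp
  then have "span (periods X) = UNIV"
    using periods_span[OF \<open>x \<in> X\<close> rep[OF \<open>x \<in> X\<close>]] by blast
  then show ?thesis
    using periods_span_imp_ideal_crystal[OF assms(1)] by blast
qed

end
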